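(* Let $Z=z_1e_1+z_2e_2$, $\mathcal{V}=\nu_1e_1+\nu_2e_2=\alpha+j\beta$ ($\alpha,\beta\in\mathbb{C}(i)$), $C=c_1e_1+c_2e_2\in\mathbb{BC}$ with $\Re(\alpha)+1>|\Im(\beta)|$. Then $$E_{\mathcal{V},C}(Z)=\frac{Z^{\mathcal{V}}}{\Gamma(\mathcal{V}+1)}\left[1+\sum_{r=1}^{\infty}\frac{1}{\Gamma(r)}\int_{D}\frac{(CZt)^r(1-t)^{\mathcal{V}}}{t}\,dt\right],$$ where $D=(D_1(t_1),D_2(t_2))$ is the curve in $\mathbb{BC}$ with variable $t=t_1e_1+t_2e_2$, $0\le t_1,t_2\le 1$.
   Context: Bicomplex numbers: $\mathbb{BC}=\{w_1+jw_2: w_1,w_2\in\mathbb{C}(i)\}$, where $\mathbb{C}(i)$ is the complex field with unit $i$, $i^2=j^2=-1$, $ij=ji$. Put $e_1=\frac{1+ij}{2}$, $e_2=\frac{1-ij}{2}$, so $e_1+e_2=1$, $e_l^2=e_l$, $e_1e_2=0$. Every $Z=w_1+jw_2$ is uniquely $Z=z_1e_1+z_2e_2$ with $z_1=w_1-iw_2$, $z_2=w_1+iw_2\in\mathbb{C}(i)$, and addition, multiplication and division are componentwise in $e_1,e_2$; in particular $\nu_1=\alpha-i\beta$, $\nu_2=\alpha+i\beta$. Functions act componentwise: $\Gamma(Y)=\Gamma(y_1)e_1+\Gamma(y_2)e_2$ for $Y=y_1e_1+y_2e_2$ (with $1/\Gamma$ equal to $0$ at the poles of $\Gamma$), and $Z^{W}=z_1^{w_1}e_1+z_2^{w_2}e_2$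 for $Z=z_1e_1+z_2e_2$, $W=w_1e_1+w_2e_2$ (principal complex powers; usual powers with $0^0=1$ for integer exponents). Identities are understood for $Z$ at which the occurring powers are defined (e.g. $z_1z_2\neq0$). Bicomplex Miller-Ross function: $E_{\mathcal{V},C}(Z)=Z^{\mathcal{V}}\sum_{r=0}^{\infty}\frac{(CZ)^r}{\Gamma(\mathcal{V}+r+1)}$ for $\mathcal{V},C,Z\in\mathbb{BC}$. Integration: for a bicomplex curve $D=(D_1,D_2)$ with component curves $D_1,D_2$ in $\mathbb{C}(i)$, $\int_D f(t)\,dt=\left[\int_{D_1}f_1(t_1)dt_1\right]e_1+\left[\int_{D_2}f_2(t_2)dt_2\right]e_2$, where $f=f_1e_1+f_2e_2$ componentwise. Here $D_1,D_2$ are the segment $[0,1]$ traversed from $0$ to $1$. *)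

theory Defs
  imports "HOL-Complex_Analysis.Complex_Analysis"
begin

text \<open>\<^term>\<open>Bicomplex w1 w2\<close> stands for $w_1 + j w_2$; the type \<^typ>\<open>complex\<close> plays the role
  of $\mathbb{C}(i)$.\<close>

datatype bicomplex = Bicomplex (bc_fst: complex) (bc_snd: complex)

lemma bicomplex_eq_iff: "x = y \<longleftrightarrow> bc_fst x = bc_fst y \<and> bc_snd x = bc_snd y"
  by (cases x; cases y) simp

instantiation bicomplex :: comm_ring_1
begin

definition "0 = Bicomplex 0 0"
definition "1 = Bicomplex 1 0"
definition "x + y = Bicomplex (bc_fst x + bc_fst y) (bc_snd x + bc_snd y)"
definition "- x = Bicomplex (- bc_fst x) (- bc_snd x)"
definition "x - y = Bicomplex (bc_fst x - bc_fst y) (bc_snd x - bc_snd y)"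
definition "x * y = Bicomplex (bc_fst x * bc_fst y - bc_snd x * bc_snd y)
                              (bc_fst x * bc_snd y + bc_snd x * bc_fst y)"

instance
  by standard
    (simp_all add: bicomplex_eq_iff zero_bicomplex_def one_bicomplex_def plus_bicomplex_def
      uminus_bicomplex_def minus_bicomplex_def times_bicomplex_def algebra_simps)

end

text \<open>The topology, with respect to which series of bicomplex numbers are summed, is that of the
  Euclidean norm $\sqrt{|w_1|^2 + |w_2|^2}$.\<close>

instantiation bicomplex :: scaleR
begin

definition "a *\<^sub>R x = Bicomplex (a *\<^sub>R bc_fst x) (a *\<^sub>R bc_snd x)"

instance ..

end

instantiation bicomplex :: real_normed_vector
begin

definition "norm x = sqrt ((norm (bc_fst x))\<^sup>2 + (norm (bc_snd x))\<^sup>2)"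
definition "sgn x = x /\<^sub>R norm x" for x :: bicomplex
definition "dist x y = norm (x - y)" for x y :: bicomplex
definition "uniformity = (INF e\<in>{0 <..}. principal {(x :: bicomplex, y). dist x y < e})"
definition "open U \<longleftrightarrow> (\<forall>x\<in>U. eventually (\<lambda>(x', y). x' = x \<longrightarrow> y \<in> U) uniformity)"
  for U :: "bicomplex set"

instance
proof
  fix a b :: real and x y :: bicomplex
  have norm_prod: "norm z = norm (bc_fst z, bc_snd z)" for z
    by (simp add: norm_bicomplex_def norm_prod_def)
  show "a *\<^sub>R (x + y) = a *\<^sub>R x + a *\<^sub>R y" "(a + b) *\<^sub>R x = a *\<^sub>R x + b *\<^sub>R x"
    "a *\<^sub>R b *\<^sub>R x = (a * b) *\<^sub>R x" "1 *\<^sub>R x = x"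
    by (simp_all add: bicomplex_eq_iff scaleR_bicomplex_def plus_bicomplex_def algebra_simps)
  show "norm x = 0 \<longleftrightarrow> x = 0"
    by (simp add: norm_prod bicomplex_eq_iff zero_bicomplex_def prod_eq_iff)
  show "norm (x + y) \<le> norm x + norm y"
    using norm_triangle_ineq[of "(bc_fst x, bc_snd x)" "(bc_fst y, bc_snd y)"]
    by (simp add: norm_prod plus_bicomplex_def)
  show "norm (a *\<^sub>R x) = \<bar>a\<bar> * norm x"
    using norm_scaleR[of a "(bc_fst x, bc_snd x)"]
    by (simp add: norm_prod scaleR_bicomplex_def del: norm_scaleR)
qed (fact sgn_bicomplex_def dist_bicomplex_def uniformity_bicomplex_def open_bicomplex_def)+

end

definition bc_of_complex :: "complex \<Rightarrow> bicomplex" where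
  "bc_of_complex w = Bicomplex w 0"

definition bc_j :: bicomplex where
  "bc_j = Bicomplex 0 1"

definition bc_e1 :: bicomplex where
  "bc_e1 = (1 / 2) *\<^sub>R (1 + bc_of_complex \<i> * bc_j)"

definition bc_e2 :: bicomplex where
  "bc_e2 = (1 / 2) *\<^sub>R (1 - bc_of_complex \<i> * bc_j)"

definition bc_idem :: "complex \<Rightarrow> complex \<Rightarrow> bicomplex" where
  "bc_idem z1 z2 = bc_of_complex z1 * bc_e1 + bc_of_complex z2 * bc_e2"

definition bc_pr1 :: "bicomplex \<Rightarrow> complex" where
  "bc_pr1 Z = bc_fst Z - \<i> * bc_snd Z"

definition bc_pr2 :: "bicomplex \<Rightarrow> complex" where
  "bc_pr2 Z = bc_fst Z + \<i> * bc_snd Z"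

lemmas bc_defs = zero_bicomplex_def one_bicomplex_def plus_bicomplex_def uminus_bicomplex_def
  minus_bicomplex_def times_bicomplex_def scaleR_bicomplex_def bc_of_complex_def bc_j_def
  bc_e1_def bc_e2_def bc_idem_def bc_pr1_def bc_pr2_def

lemma Bicomplex_eq: "Bicomplex w1 w2 = bc_of_complex w1 + bc_j * bc_of_complex w2"
  by (simp add: bicomplex_eq_iff bc_defs)

lemma bc_units:
  "bc_j * bc_j = - 1" "bc_of_complex \<i> * bc_of_complex \<i> = - 1"
  "bc_e1 + bc_e2 = 1" "bc_e1 * bc_e1 = bc_e1" "bc_e2 * bc_e2 = bc_e2" "bc_e1 * bc_e2 = 0"
  by (simp_all add: bicomplex_eq_iff bc_defs field_simps scaleR_conv_of_real)

lemma bc_pr_idem [simp]: "bc_pr1 (bc_idem z1 z2) = z1" "bc_pr2 (bc_idem z1 z2) = z2"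
  by (simp_all add: bc_defs scaleR_conv_of_real field_simps)

lemma bc_idem_pr [simp]: "bc_idem (bc_pr1 Z) (bc_pr2 Z) = Z"
  by (simp add: bicomplex_eq_iff bc_defs scaleR_conv_of_real field_simps)

lemma bc_eq_iff_pr: "Z = W \<longleftrightarrow> bc_pr1 Z = bc_pr1 W \<and> bc_pr2 Z = bc_pr2 W"
  by (metis bc_idem_pr)

lemma bc_pr_simps [simp]:
  "bc_pr1 0 = 0" "bc_pr2 0 = 0" "bc_pr1 1 = 1" "bc_pr2 1 = 1"
  "bc_pr1 (Z + W) = bc_pr1 Z + bc_pr1 W" "bc_pr2 (Z + W) = bc_pr2 Z + bc_pr2 W"
  "bc_pr1 (Z - W) = bc_pr1 Z - bc_pr1 W" "bc_pr2 (Z - W) = bc_pr2 Z - bc_pr2 W"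
  "bc_pr1 (Z * W) = bc_pr1 Z * bc_pr1 W" "bc_pr2 (Z * W) = bc_pr2 Z * bc_pr2 W"
  by (simp_all add: bc_defs algebra_simps)

text \<open>Since \<open>inverse 0 = 0\<close> in \<^typ>\<open>complex\<close>, a component of a quotient is \<open>0\<close> where the
  corresponding component of the divisor vanishes.\<close>

instantiation bicomplex :: inverse
begin

definition "inverse Z = bc_idem (inverse (bc_pr1 Z)) (inverse (bc_pr2 Z))"
definition "Z div W = bc_idem (bc_pr1 Z / bc_pr1 W) (bc_pr2 Z / bc_pr2 W)" for Z W :: bicomplex

instance ..

end

text \<open>At its poles the library function \<^const>\<open>Gamma\<close> has the value \<open>0\<close>. Together with the
  convention above, a component of \<open>Z / bc_Gamma Y\<close> is \<open>0\<close> at the poles, which is the convention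
  $1/\Gamma = 0$.\<close>

definition bc_Gamma :: "bicomplex \<Rightarrow> bicomplex" where
  "bc_Gamma Y = bc_idem (Gamma (bc_pr1 Y)) (Gamma (bc_pr2 Y))"

text \<open>The library has \<open>0 powr 0 = 0\<close>; wherever else the power is defined, \<open>powr\<close> is the principal one,
  which for integer exponents is the usual one.\<close>

definition cpow :: "complex \<Rightarrow> complex \<Rightarrow> complex" where
  "cpow z w = (if w = 0 then 1 else z powr w)"

definition bc_powr :: "bicomplex \<Rightarrow> bicomplex \<Rightarrow> bicomplex" where
  "bc_powr Z W = bc_idem (cpow (bc_pr1 Z) (bc_pr1 W)) (cpow (bc_pr2 Z) (bc_pr2 W))"

text \<open>Where $z^w$ is defined: for base \<open>0\<close>, when $w = 0$ (value \<open>1\<close>) or $\Re w > 0$ (value \<open>0\<close>).\<close>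

definition cpow_defined :: "complex \<Rightarrow> complex \<Rightarrow> bool" where
  "cpow_defined z w \<longleftrightarrow> z \<noteq> 0 \<or> w = 0 \<or> Re w > 0"

definition bc_powr_defined :: "bicomplex \<Rightarrow> bicomplex \<Rightarrow> bool" where
  "bc_powr_defined Z W \<longleftrightarrow>
     cpow_defined (bc_pr1 Z) (bc_pr1 W) \<and> cpow_defined (bc_pr2 Z) (bc_pr2 W)"

definition miller_ross :: "bicomplex \<Rightarrow> bicomplex \<Rightarrow> bicomplex \<Rightarrow> bicomplex" where
  "miller_ross V C Z =
     bc_powr Z V * (\<Sum>r. (C * Z) ^ r / bc_Gamma (V + of_nat r + 1))"

text \<open>A bicomplex curve is the pair of its component curves. Only functions acting componentwise
  along the curve have an integral. The values of the integrand at the end points (where it may be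
  singular) do not matter, \<open>has_contour_integral\<close> being a gauge integral over the parameter.\<close>

type_synonym bc_curve = "(real \<Rightarrow> complex) \<times> (real \<Rightarrow> complex)"

definition has_bc_contour_integral ::
    "(bicomplex \<Rightarrow> bicomplex) \<Rightarrow> bicomplex \<Rightarrow> bc_curve \<Rightarrow> bool" where
  "has_bc_contour_integral f I D \<longleftrightarrow>
     (\<exists>f1 f2.
        (\<forall>t1\<in>path_image (fst D). \<forall>t2\<in>path_image (snd D).
           f (bc_idem t1 t2) = bc_idem (f1 t1) (f2 t2)) \<and>
        (f1 has_contour_integral bc_pr1 I) (fst D) \<and>
        (f2 has_contour_integral bc_pr2 I) (snd D))"

definition bc_contour_integrable_on :: "(bicomplex \<Rightarrow> bicomplex) \<Rightarrow> bc_curve \<Rightarrow> bool" where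
  "bc_contour_integrable_on f D \<longleftrightarrow> (\<exists>I. has_bc_contour_integral f I D)"

definition bc_contour_integral :: "bc_curve \<Rightarrow> (bicomplex \<Rightarrow> bicomplex) \<Rightarrow> bicomplex" where
  "bc_contour_integral D f = (THE I. has_bc_contour_integral f I D)"

lemma has_bc_contour_integral_unique:
  assumes "has_bc_contour_integral f I D" "has_bc_contour_integral f J D"
  shows "I = J"
proof -
  obtain f1 f2 where f: "\<forall>t1\<in>path_image (fst D). \<forall>t2\<in>path_image (snd D).
        f (bc_idem t1 t2) = bc_idem (f1 t1) (f2 t2)"
      "(f1 has_contour_integral bc_pr1 I) (fst D)" "(f2 has_contour_integral bc_pr2 I) (snd D)"
    using assms(1) unfolding has_bc_contour_integral_def by blast
  obtain g1 g2 where g: "\<forall>t1\<in>path_image (fst D). \<forall>t2\<in>path_image (snd D).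
        f (bc_idem t1 t2) = bc_idem (g1 t1) (g2 t2)"
      "(g1 has_contour_integral bc_pr1 J) (fst D)" "(g2 has_contour_integral bc_pr2 J) (snd D)"
    using assms(2) unfolding has_bc_contour_integral_def by blast
  obtain a b where ab: "a \<in> path_image (fst D)" "b \<in> path_image (snd D)"
    by (metis path_image_nonempty ex_in_conv)
  have "f1 t = g1 t" if "t \<in> path_image (fst D)" for t
    using f(1) g(1) ab(2) that by (metis bc_pr_idem(1))
  then have "bc_pr1 I = bc_pr1 J"
    using has_contour_integral_eq[OF f(2)] g(2) has_contour_integral_unique by blast
  moreover have "f2 t = g2 t" if "t \<in> path_image (snd D)" for t
    using f(1) g(1) ab(1) that by (metis bc_pr_idem(2))
  then have "bc_pr2 I = bc_pr2 J"
    using has_contour_integral_eq[OF f(3)] g(3) has_contour_integral_unique by blast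
  ultimately show ?thesis
    by (simp add: bc_eq_iff_pr)
qed

lemma bc_contour_integral_unique:
  "has_bc_contour_integral f I D \<Longrightarrow> bc_contour_integral D f = I"
  unfolding bc_contour_integral_def using has_bc_contour_integral_unique by blast

end

theory Submission
  imports Defs
begin

text \<open>Everything splits into the two idempotent components, with exponents
  $\nu_1 = \alpha - i\beta$ and $\nu_2 = \alpha + i\beta$; the hypothesis on $\alpha$ and $\beta$ says
  precisely that $\Re\nu_l > -1$ for both $l$. In each component the integral is the Beta integral
  $B(r, \nu + 1) = \Gamma(r)\Gamma(\nu + 1)/\Gamma(\nu + r + 1)$, so the two series agree term by term.\<close>

section \<open>The Beta integral with a positive integer as first argument\<close>

lemma complex_Gamma_plus1:
  fixes z :: complex
  assumes "Re z > 0"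
  shows "Gamma (z + 1) = z * Gamma z" "Gamma z \<noteq> 0"
proof -
  have "z \<notin> \<int>\<^sub>\<le>\<^sub>0"
    using assms by (auto elim!: nonpos_Ints_cases)
  then show "Gamma (z + 1) = z * Gamma z" "Gamma z \<noteq> 0"
    by (simp_all add: Gamma_plus1 Gamma_eq_zero_iff)
qed

lemma has_vector_derivative_one_minus_powr:
  fixes s :: complex and x :: real
  assumes "x < 1"
  shows "((\<lambda>x. (1 - of_real x) powr (s + 1)) has_vector_derivative
    - ((s + 1) * (1 - of_real x) powr s)) (at x)"
proof -
  have "1 - complex_of_real x \<notin> \<real>\<^sub>\<le>\<^sub>0"
    using assms by (auto simp: complex_nonpos_Reals_iff)
  moreover have "((\<lambda>z. 1 - z) has_field_derivative -1) (at (complex_of_real x))"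
    by (auto intro!: derivative_eq_intros)
  ultimately have "((\<lambda>z. (1 - z) powr (s + 1)) has_field_derivative
      (s + 1) * (1 - of_real x) powr (s + 1 - 1) * - 1) (at (complex_of_real x))"
    by (intro DERIV_chain2[OF has_field_derivative_powr])
  then show ?thesis
    by (auto dest: has_vector_derivative_real_field)
qed

text \<open>The positive real part gives continuity even at \<open>x = 1\<close>, where the base
  vanishes. It is applied to the exponent \<open>s + 1\<close> of antiderivatives, so
  \<open>Re s > -1\<close> suffices there.\<close>

lemma continuous_on_one_minus_powr:
  fixes s :: complex
  assumes "Re s > 0"
  shows "continuous_on {0..1::real} (\<lambda>x. (1 - of_real x) powr s)"
  by (intro continuous_on_powr_complex continuous_intros) (use assms in auto)

text \<open>The value is B(n + 1, s + 1). Integration by parts lowers \<open>n\<close> while raising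
  \<open>s\<close> to \<open>s + 1\<close>, so the induction keeps \<open>s\<close>
  arbitrary.\<close>

lemma has_integral_complex_Beta_nat:
  fixes s :: complex
  assumes "Re s > -1"
  shows "((\<lambda>x. of_real x ^ n * (1 - of_real x) powr s) has_integral
    fact n * Gamma (s + 1) / Gamma (s + of_nat n + 2)) {0..1::real}"
  using assms
proof (induction n arbitrary: s)
  case (0 s)
  define F where "F = (\<lambda>x::real. - ((1 - of_real x) powr (s + 1) / (s + 1)))"
  have s1: "s + 1 \<noteq> 0"
    using 0 by (auto simp: complex_eq_iff)
  \<comment> \<open>The integrand may blow up at 1, so the fundamental theorem is used in the form
    that asks for derivatives only in the interior and continuity of \<open>F\<close> up to the end
    points.\<close>
  have "((\<lambda>x. (1 - of_real x) powr s) has_integral F 1 - F 0) {0..1::real}"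
  proof (rule fundamental_theorem_of_calculus_interior)
    show "continuous_on {0..1} F"
      unfolding F_def using 0 s1
      by (intro continuous_intros continuous_on_one_minus_powr) auto
    show "(F has_vector_derivative (1 - of_real x) powr s) (at x)" if "x \<in> {0<..<1}" for x
    proof -
      have "(F has_vector_derivative - (- ((s + 1) * (1 - of_real x) powr s) / (s + 1))) (at x)"
        unfolding F_def using that
        by (intro has_vector_derivative_minus has_vector_derivative_divide
              has_vector_derivative_one_minus_powr) auto
      then show ?thesis
        using s1 by simp
    qed
  qed simp
  moreover have "F 1 - F 0 = Gamma (s + 1) / Gamma (s + 2)"
  proof -
    have "Gamma (s + 2) = (s + 1) * Gamma (s + 1)" "Gamma (s + 1) \<noteq> 0"
      using complex_Gamma_plus1[of "s + 1"] 0 by (simp_all add: add.assoc)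
    then show ?thesis
      using s1 by (simp add: F_def)
  qed
  ultimately show ?case
    by simp
next
  case (Suc n s)
  \<comment> \<open>\<open>G\<close> is the derivative of \<open>F\<close> by the product rule.
    Since \<open>F\<close> vanishes at 0 and 1, \<open>G\<close> integrates to 0.\<close>
  define F where "F = (\<lambda>x::real. of_real x ^ Suc n * (1 - complex_of_real x) powr (s + 1))"
  define G where "G = (\<lambda>x::real. of_real x ^ Suc n * - ((s + 1) * (1 - of_real x) powr s) +
    of_nat (Suc n) * (of_real x ^ n * (1 - complex_of_real x) powr (s + 1)))"
  have s1: "s + 1 \<noteq> 0"
    using Suc.prems by (auto simp: complex_eq_iff)
  have "(G has_integral F 1 - F 0) {0..1}"
  proof (rule fundamental_theorem_of_calculus_interior)
    show "continuous_on {0..1} F"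
      unfolding F_def using Suc.prems
      by (intro continuous_intros continuous_on_one_minus_powr) auto
    show "(F has_vector_derivative G x) (at x)" if "x \<in> {0<..<1}" for x
    proof -
      have "((\<lambda>x. complex_of_real x ^ Suc n) has_vector_derivative
          of_nat (Suc n) * of_real x ^ n) (at x)"
        using DERIV_power_Suc[OF DERIV_ident, of n "of_real x" UNIV]
        by (intro has_vector_derivative_real_field) simp
      from has_vector_derivative_mult[OF this has_vector_derivative_one_minus_powr[of x s]] that
      show ?thesis
        by (simp add: F_def G_def mult.assoc)
    qed
  qed simp
  then have G: "(G has_integral 0) {0..1}"
    by (simp add: F_def)
  have IH: "((\<lambda>x. of_real x ^ n * (1 - of_real x) powr (s + 1)) has_integral
      fact n * Gamma (s + 1 + 1) / Gamma (s + 1 + of_nat n + 2)) {0..1::real}"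
    using Suc.prems by (intro Suc.IH) auto
  \<comment> \<open>Solving the formula for \<open>G\<close> for its first summand expresses the
    wanted integrand through \<open>G\<close> and the integrand of the induction hypothesis.\<close>
  have "((\<lambda>x. (of_nat (Suc n) * (of_real x ^ n * (1 - of_real x) powr (s + 1)) - G x) / (s + 1))
      has_integral (of_nat (Suc n) * (fact n * Gamma (s + 1 + 1) / Gamma (s + 1 + of_nat n + 2)) - 0)
        / (s + 1)) {0..1}"
    by (intro has_integral_divide has_integral_diff has_integral_mult_right G IH)
  also have "(\<lambda>x. (of_nat (Suc n) * (of_real x ^ n * (1 - of_real x) powr (s + 1)) - G x) / (s + 1)) =
      (\<lambda>x. of_real x ^ Suc n * (1 - of_real x) powr s)"
    using s1 by (simp add: G_def fun_eq_iff)
  also have "(of_nat (Suc n) * (fact n * Gamma (s + 1 + 1) / Gamma (s + 1 + of_nat n + 2)) - 0) / (s + 1)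
      = fact (Suc n) * Gamma (s + 1) / Gamma (s + of_nat (Suc n) + 2)"
  proof -
    have "Gamma (s + 1 + 1) = (s + 1) * Gamma (s + 1)"
      using Suc.prems by (intro complex_Gamma_plus1) auto
    moreover have "s + 1 + of_nat n + 2 = s + of_nat (Suc n) + 2"
      by simp
    ultimately show ?thesis
      using s1 by simp
  qed
  finally show ?case .
qed

text \<open>With r = n + 1, one factor \<open>t\<close> of the power cancels the divisor
  \<open>t\<close>, which leaves x^r times the integrand of B(r, v + 1).\<close>

lemma has_contour_integral_Beta:
  fixes x v :: complex
  assumes "Re v > -1"
  shows "((\<lambda>t. (x * t) ^ Suc n * cpow (1 - t) v / t) has_contour_integral
    x ^ Suc n * (fact n * Gamma (v + 1) / Gamma (v + of_nat n + 2))) (linepath 0 1)"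
proof -
  have "((\<lambda>t. x ^ Suc n * (of_real t ^ n * (1 - of_real t) powr v)) has_integral
      x ^ Suc n * (fact n * Gamma (v + 1) / Gamma (v + of_nat n + 2))) {0..1::real}"
    by (intro has_integral_mult_right has_integral_complex_Beta_nat assms)
  \<comment> \<open>The integrands may differ at the end points: at 0 for \<open>n = 0\<close>,
    because division by 0 yields 0, and at 1 for \<open>v = 0\<close>, because
    \<open>cpow 0 0 = 1\<close> but \<open>0 powr 0 = 0\<close>.\<close>
  then have "((\<lambda>t. (x * of_real t) ^ Suc n * cpow (1 - of_real t) v / of_real t) has_integral
      x ^ Suc n * (fact n * Gamma (v + 1) / Gamma (v + of_nat n + 2))) {0..1::real}"
    by (rule has_integral_spike_finite[of "{0, 1}", rotated 2])
       (auto simp: cpow_def field_simps)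
  then show ?thesis
    unfolding has_contour_integral_linepath by (simp add: linepath_def scaleR_conv_of_real)
qed

section \<open>The component series\<close>

lemma summable_power_over_Gamma:
  fixes x v :: complex
  assumes "Re v > -1"
  shows "summable (\<lambda>r. x ^ r / Gamma (v + of_nat r + 1))"
\<comment> \<open>The ratio of consecutive terms is x / (v + n + 1). Since Re (v + n + 1) > n, it
  has modulus at most 1/2 once n is at least 2|x|.\<close>
proof (rule summable_ratio_test[where c = "1/2" and N = "nat \<lceil>2 * norm x\<rceil> + 1"])
  fix n
  assume n: "n \<ge> nat \<lceil>2 * norm x\<rceil> + 1"
  define w where "w = v + of_nat n + 1"
  have "2 * norm x \<le> Re w"
    using n assms unfolding w_def by simp linarith
  also have "Re w \<le> norm w"
    by (rule complex_Re_le_cmod)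
  finally have le: "2 * norm x \<le> norm w" .
  have pos: "Re w > 0"
    using assms by (simp add: w_def)
  then have "w \<noteq> 0"
    by auto
  have "x ^ Suc n / Gamma (v + of_nat (Suc n) + 1) = (x / w) * (x ^ n / Gamma w)"
    using complex_Gamma_plus1[OF pos] by (simp add: w_def add_ac)
  moreover have "norm (x / w) \<le> 1/2"
    using le \<open>w \<noteq> 0\<close> by (simp add: norm_divide field_simps)
  ultimately have "norm (x ^ Suc n / Gamma (v + of_nat (Suc n) + 1)) \<le>
      1/2 * norm (x ^ n / Gamma w)"
    by (metis norm_mult mult_right_mono norm_ge_zero)
  then show "norm (x ^ Suc n / Gamma (v + of_nat (Suc n) + 1)) \<le>
      1/2 * norm (x ^ n / Gamma (v + of_nat n + 1))"
    by (simp only: w_def)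
qed simp

text \<open>As Gamma (r + 1) = r!, each term reduces to \<open>Gamma (v + 1)\<close> times the term
  of index \<open>Suc r\<close> of the series on the right. The missing term of index 0 is
  \<open>1 / Gamma (v + 1)\<close>, whence the \<open>- 1\<close>.\<close>

lemma Beta_series_sums:
  fixes x v :: complex
  assumes "Re v > -1"
  shows "(\<lambda>r. 1 / Gamma (of_nat (Suc r)) *
      (x ^ Suc r * (fact r * Gamma (v + 1) / Gamma (v + of_nat r + 2))))
    sums (Gamma (v + 1) * (\<Sum>r. x ^ r / Gamma (v + of_nat r + 1)) - 1)"
proof -
  have g: "Gamma (v + 1) \<noteq> 0"
    using assms by (intro complex_Gamma_plus1) auto
  have "(\<lambda>r. x ^ Suc r / Gamma (v + of_nat (Suc r) + 1)) sums
      ((\<Sum>r. x ^ r / Gamma (v + of_nat r + 1)) - 1 / Gamma (v + 1))"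
    using summable_sums[OF summable_power_over_Gamma[OF assms, of x]]
    by (subst sums_Suc_iff) simp
  from sums_mult[OF this, of "Gamma (v + 1)"]
  have "(\<lambda>r. Gamma (v + 1) * (x ^ Suc r / Gamma (v + of_nat (Suc r) + 1))) sums
      (Gamma (v + 1) * (\<Sum>r. x ^ r / Gamma (v + of_nat r + 1)) - 1)"
    using g by (simp add: right_diff_distrib)
  moreover have "1 / Gamma (of_nat (Suc r)) *
      (x ^ Suc r * (fact r * Gamma (v + 1) / Gamma (v + of_nat r + 2))) =
      Gamma (v + 1) * (x ^ Suc r / Gamma (v + of_nat (Suc r) + 1))" for r
  proof -
    have "Gamma (of_nat (Suc r) :: complex) = fact r"
      using Gamma_fact[of r, where 'a = complex] by (simp add: add_ac)
    moreover have "v + of_nat (Suc r) + 1 = v + of_nat r + 2"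
      by simp
    ultimately show ?thesis
      by (simp only:) simp
  qed
  ultimately show ?thesis
    by presburger
qed

section \<open>Transfer to bicomplex numbers\<close>

lemma bc_pr_divide [simp]:
  "bc_pr1 (Z / W) = bc_pr1 Z / bc_pr1 W" "bc_pr2 (Z / W) = bc_pr2 Z / bc_pr2 W"
  by (simp_all add: divide_bicomplex_def)

lemma bc_pr_power [simp]: "bc_pr1 (Z ^ n) = bc_pr1 Z ^ n" "bc_pr2 (Z ^ n) = bc_pr2 Z ^ n"
  by (induction n) simp_all

lemma bc_pr_of_nat [simp]: "bc_pr1 (of_nat n) = of_nat n" "bc_pr2 (of_nat n) = of_nat n"
  by (induction n) simp_all

lemma bc_pr_Gamma [simp]:
  "bc_pr1 (bc_Gamma Y) = Gamma (bc_pr1 Y)" "bc_pr2 (bc_Gamma Y) = Gamma (bc_pr2 Y)"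
  by (simp_all add: bc_Gamma_def)

lemma bc_pr_powr [simp]:
  "bc_pr1 (bc_powr Z W) = cpow (bc_pr1 Z) (bc_pr1 W)"
  "bc_pr2 (bc_powr Z W) = cpow (bc_pr2 Z) (bc_pr2 W)"
  by (simp_all add: bc_powr_def)

lemma bounded_linear_bc_idem:
  "bounded_linear (\<lambda>z. bc_idem z 0)" "bounded_linear (\<lambda>z. bc_idem 0 z)"
proof -
  have eq: "bc_idem z 0 = Bicomplex (z / 2) (\<i> * z / 2)"
    "bc_idem 0 z = Bicomplex (z / 2) (- (\<i> * z / 2))" for z
    by (simp_all add: bicomplex_eq_iff bc_defs scaleR_conv_of_real)
  \<comment> \<open>Both coordinates of an embedded \<open>z\<close> have modulus |z|/2, so its
    Euclidean norm is |z|/sqrt 2.\<close>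
  have half: "norm (Bicomplex (z / 2) w) \<le> norm z * 1" if w: "norm w = norm z / 2" for z w
  proof -
    have "(cmod z / 2)\<^sup>2 + (cmod z / 2)\<^sup>2 \<le> (cmod z)\<^sup>2"
      by (simp add: power_divide)
    then show ?thesis
      using w by (simp add: norm_bicomplex_def norm_divide real_le_lsqrt del: eq_divide_eq_numeral1)
  qed
  show "bounded_linear (\<lambda>z. bc_idem z 0)"
  proof (rule bounded_linear_intro)
    show "norm (bc_idem z 0) \<le> norm z * 1" for z
      unfolding eq by (rule half) (simp add: norm_divide norm_mult)
  qed (simp_all add: eq bc_defs scaleR_conv_of_real field_simps)
  show "bounded_linear (\<lambda>z. bc_idem 0 z)"
  proof (rule bounded_linear_intro)
    show "norm (bc_idem 0 z) \<le> norm z * 1" for z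
      unfolding eq by (rule half) (simp add: norm_divide norm_mult)
  qed (simp_all add: eq bc_defs scaleR_conv_of_real field_simps)
qed

text \<open>The two idempotent embeddings are bounded linear, hence carry complex series to series
  convergent in the Euclidean norm; adding them recovers \<open>f\<close>.\<close>

lemma sums_bc_idem:
  assumes "(\<lambda>r. bc_pr1 (f r)) sums a" "(\<lambda>r. bc_pr2 (f r)) sums b"
  shows "f sums bc_idem a b"
proof -
  have split: "bc_idem x y = bc_idem x 0 + bc_idem 0 y" for x y
    by (simp add: bc_eq_iff_pr)
  have "(\<lambda>r. bc_idem (bc_pr1 (f r)) 0 + bc_idem 0 (bc_pr2 (f r))) sums (bc_idem a 0 + bc_idem 0 b)"
    by (intro sums_add bounded_linear.sums[OF bounded_linear_bc_idem(1)]
        bounded_linear.sums[OF bounded_linear_bc_idem(2)] assms)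
  then show ?thesis
    by (simp flip: split)
qed

theorem theorem3p1:
  fixes Z V C :: bicomplex and \<alpha> \<beta> :: complex and D :: bc_curve
  assumes "V = bc_of_complex \<alpha> + bc_j * bc_of_complex \<beta>"
    and "Re \<alpha> + 1 > \<bar>Im \<beta>\<bar>"
    and "bc_powr_defined Z V"
    and "D = (linepath 0 1, linepath 0 1)"
  shows "summable (\<lambda>r. (C * Z) ^ r / bc_Gamma (V + of_nat r + 1)) \<and>
    (\<forall>r\<ge>1. bc_contour_integrable_on (\<lambda>t. (C * Z * t) ^ r * bc_powr (1 - t) V / t) D) \<and>
    summable (\<lambda>r. 1 / bc_Gamma (of_nat (Suc r)) *
      bc_contour_integral D (\<lambda>t. (C * Z * t) ^ Suc r * bc_powr (1 - t) V / t)) \<and>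
    miller_ross V C Z = bc_powr Z V / bc_Gamma (V + 1) *
      (1 + (\<Sum>r. 1 / bc_Gamma (of_nat (Suc r)) *
        bc_contour_integral D (\<lambda>t. (C * Z * t) ^ Suc r * bc_powr (1 - t) V / t)))"
proof -
  define v1 v2 x1 x2 where defs: "v1 = bc_pr1 V" "v2 = bc_pr2 V"
    "x1 = bc_pr1 (C * Z)" "x2 = bc_pr2 (C * Z)"
  \<comment> \<open>The real parts are Re \<alpha> + Im \<beta> and Re \<alpha> - Im
    \<beta>.\<close>
  have v: "Re v1 > -1" "Re v2 > -1"
    using assms(2) by (simp_all add: defs assms(1) bc_defs abs_less_iff)
  have g: "Gamma (v1 + 1) \<noteq> 0" "Gamma (v2 + 1) \<noteq> 0"
    using v by (auto intro!: complex_Gamma_plus1)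
  define S where "S = (\<lambda>x v::complex. \<Sum>r. x ^ r / Gamma (v + of_nat r + 1))"
  define J where "J = (\<lambda>x (v::complex) n. x ^ Suc n *
    (fact n * Gamma (v + 1) / Gamma (v + of_nat n + 2)))"

  have mr: "(\<lambda>r. (C * Z) ^ r / bc_Gamma (V + of_nat r + 1)) sums bc_idem (S x1 v1) (S x2 v2)"
    using summable_sums[OF summable_power_over_Gamma] v
    by (intro sums_bc_idem) (simp_all add: S_def defs)
  have int: "has_bc_contour_integral (\<lambda>t. (C * Z * t) ^ Suc n * bc_powr (1 - t) V / t)
      (bc_idem (J x1 v1 n) (J x2 v2 n)) D" for n
    unfolding has_bc_contour_integral_def
  proof (intro exI conjI ballI)
    \<comment> \<open>This equation fixes the component integrands. It holds for all
      \<open>t1\<close> and \<open>t2\<close>, including 0, as bicomplex division is componentwise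
      with the same default value.\<close>
    show "(C * Z * bc_idem t1 t2) ^ Suc n * bc_powr (1 - bc_idem t1 t2) V / bc_idem t1 t2 =
        bc_idem ((x1 * t1) ^ Suc n * cpow (1 - t1) v1 / t1)
          ((x2 * t2) ^ Suc n * cpow (1 - t2) v2 / t2)" for t1 t2
      by (simp add: bc_eq_iff_pr defs)
  qed (use has_contour_integral_Beta v in \<open>simp_all add: assms(4) J_def del: power_Suc\<close>)
  have beta: "(\<lambda>r. 1 / bc_Gamma (of_nat (Suc r)) *
        bc_contour_integral D (\<lambda>t. (C * Z * t) ^ Suc r * bc_powr (1 - t) V / t))
      sums bc_idem (Gamma (v1 + 1) * S x1 v1 - 1) (Gamma (v2 + 1) * S x2 v2 - 1)"
    unfolding bc_contour_integral_unique[OF int]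
    using Beta_series_sums[OF v(1), of x1] Beta_series_sums[OF v(2), of x2]
    by (intro sums_bc_idem) (simp_all add: S_def J_def del: of_nat_Suc power_Suc)

  show ?thesis
  proof (intro conjI allI impI)
    show "bc_contour_integrable_on (\<lambda>t. (C * Z * t) ^ r * bc_powr (1 - t) V / t) D"
      if "r \<ge> 1" for r
      \<comment> \<open>\<open>int\<close> is indexed from 0 and treats the exponent
        \<open>Suc n\<close>.\<close>
      using int[of "r - 1"] that by (auto simp: bc_contour_integrable_on_def)
    show "miller_ross V C Z = bc_powr Z V / bc_Gamma (V + 1) *
      (1 + (\<Sum>r. 1 / bc_Gamma (of_nat (Suc r)) *
        bc_contour_integral D (\<lambda>t. (C * Z * t) ^ Suc r * bc_powr (1 - t) V / t)))"
      \<comment> \<open>In each component the bracket becomes 1 + (Gamma (v + 1) S - 1), and the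
        nonzero factor Gamma (v + 1) cancels against the prefactor.\<close>
      unfolding miller_ross_def sums_unique[OF mr, symmetric] sums_unique[OF beta, symmetric]
      using g by (simp add: bc_eq_iff_pr flip: defs)
  qed (use mr beta in \<open>auto simp: sums_iff\<close>)
qed

end
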